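(* Let $k$ be a commutative ring and let $(\mathcal A_L,S,\tilde S)$ be an extended Hopf algebra, that is: $\mathcal A_L=(A,L,s_L,t_L,\gamma_L,\pi_L)$ is a left bialgebroid such that $A$ and $L$ are $k$-algebras; $S$ and $\tilde S$ are anti-automorphisms of the algebra $A$ with $\tilde S^2=\mathrm{id}_A$; both $T=S$ and $T=\tilde S$ satisfy $T\circ t_L=s_L$ and $T(a_{(1)})a_{(2)}=t_L\circ\pi_L\circ T(a)$ for all $a\in A$; $\gamma_L=p_L\circ\Delta$, where $\Delta:A\to A\otimes_kA$ is a coassociative coproduct and $p_L:A\otimes_kA\to A\otimes_LA$ is the canonical projection; and $$\Delta\circ S=(S\otimes S)\circ\Delta^{op},\qquad\Delta\circ\tilde S=(S\otimes\tilde S)\circ\Delta^{op}.$$ Then the pair $(\mathcal A_L,\tilde S)$ is a Hopf algebroid.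
   Context: A left bialgebroid $\mathcal A_L=(A,L,s_L,t_L,\gamma_L,\pi_L)$ consists of rings $A$, $L$, ring homomorphisms $s_L:L\to A$, $t_L:L^{op}\to A$ with commuting images, and a comonoid structure $\gamma_L:A\to A\otimes_LA$, $\gamma_L(a)=a_{(1)}\otimes a_{(2)}$, $\pi_L:A\to L$ on the $L$-$L$-bimodule $A$ with $l\cdot a\cdot l'=s_L(l)t_L(l')a$, satisfying $a_{(1)}t_L(l)\otimes a_{(2)}=a_{(1)}\otimes a_{(2)}s_L(l)$, $\gamma_L(1)=1\otimes1$, $\gamma_L(ab)=\gamma_L(a)\gamma_L(b)$, $\pi_L(1)=1$, $\pi_L(as_L(\pi_L(b)))=\pi_L(ab)=\pi_L(at_L(\pi_L(b)))$. A Hopf algebroid is a pair $(\mathcal A_L,S)$ with $S$ an anti-automorphism of the ring $A$ such that $S\circ t_L=s_L$ and, for all $a\in A$, in $A\otimes_LA$: $S^{-1}(a_{(2)})_{(1')}\otimes S^{-1}(a_{(2)})_{(2')}a_{(1)}=S^{-1}(a)\otimes1$ and $S(a_{(1)})_{(1')}a_{(2)}\otimes S(a_{(1)})_{(2')}=1\otimes S(a)$, where primed indices denote a further application of $\gamma_L$. The coproduct $\Delta$ is a $k$-linear coassociative map, not required to be counital; $\Delta^{op}$ is $\Delta$ followed by the flip. *)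

theory Defs
  imports
    "HOL-Library.Poly_Mapping"
    "HOL-Library.Set_Algebras"
    "HOL-Computational_Algebra.Group_Closure"
begin

text \<open>
  Unital rings are types of sort \<open>{ring, monoid_mult}\<close> and commutative unital rings are types of
  sort \<open>{comm_ring, comm_monoid_mult}\<close>.  The classes \<open>ring_1\<close> and \<open>comm_ring_1\<close> are avoided because
  they include \<open>0 \<noteq> 1\<close>, which would exclude the zero ring; the library locale \<open>module\<close>
  is not used for the same reason.

  A tensor product \<open>M \<otimes> N\<close> is the quotient of the free abelian group \<open>'m \<times> 'n \<Rightarrow>\<^sub>0 int\<close>
  by the subgroup generated by the usual relations.  Its elements are cosets \<open>u +o N\<close>, the pure
  tensor of \<open>x\<close> and \<open>y\<close> being \<open>frag_of (x, y) +o N\<close>; the sum of two elements of the quotient is the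
  sum of cosets, i.e. the sum of sets of \<^theory>\<open>HOL-Library.Set_Algebras\<close>.
  An expression \<open>a\<^sub>(\<^sub>1\<^sub>) \<otimes> a\<^sub>(\<^sub>2\<^sub>)\<close> is an element \<open>u\<close> of the coset \<open>\<gamma> a\<close>, i.e. a finite formal sum of
  pairs representing it.  An expression in which the coproduct is applied several times is
  evaluated on a choice \<open>g\<close> of such a representative for each ring element; the corresponding
  axiom is required for all representatives.
\<close>

section \<open>Tensor products\<close>

text \<open>
  \<open>lact r x\<close> is the left action \<open>r \<cdot> x\<close> and \<open>ract r x\<close> is the right action \<open>x \<cdot> r\<close>.
\<close>

definition tensor2_rel ::
  "('r \<Rightarrow> 'a::ab_group_add \<Rightarrow> 'a) \<Rightarrow> ('r \<Rightarrow> 'a \<Rightarrow> 'a) \<Rightarrow> ('a \<times> 'a \<Rightarrow>\<^sub>0 int) set" where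
  "tensor2_rel lact ract = group_closure
     ({frag_of (x + x', y) - frag_of (x, y) - frag_of (x', y) | x x' y. True} \<union>
      {frag_of (x, y + y') - frag_of (x, y) - frag_of (x, y') | x y y'. True} \<union>
      {frag_of (ract r x, y) - frag_of (x, lact r y) | r x y. True})"

definition tensor2 ::
  "('r \<Rightarrow> 'a::ab_group_add \<Rightarrow> 'a) \<Rightarrow> ('r \<Rightarrow> 'a \<Rightarrow> 'a) \<Rightarrow> ('a \<times> 'a \<Rightarrow>\<^sub>0 int) set set" where
  "tensor2 lact ract = range (\<lambda>u. u +o tensor2_rel lact ract)"

text \<open>The relations defining the threefold tensor product of a bimodule with itself,
  formed without bracketing.\<close>

definition tensor3_rel ::
  "('r \<Rightarrow> 'a::ab_group_add \<Rightarrow> 'a) \<Rightarrow> ('r \<Rightarrow> 'a \<Rightarrow> 'a) \<Rightarrow> ('a \<times> 'a \<times> 'a \<Rightarrow>\<^sub>0 int) set" where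
  "tensor3_rel lact ract = group_closure
     ({frag_of (x + x', y, z) - frag_of (x, y, z) - frag_of (x', y, z) | x x' y z. True} \<union>
      {frag_of (x, y + y', z) - frag_of (x, y, z) - frag_of (x, y', z) | x y y' z. True} \<union>
      {frag_of (x, y, z + z') - frag_of (x, y, z) - frag_of (x, y, z') | x y z z'. True} \<union>
      {frag_of (ract r x, y, z) - frag_of (x, lact r y, z) | r x y z. True} \<union>
      {frag_of (x, ract r y, z) - frag_of (x, y, lact r z) | r x y z. True})"

text \<open>\<open>left_cop g u\<close> and \<open>right_cop g u\<close> are \<open>(\<gamma> \<otimes> id)(u)\<close> and \<open>(id \<otimes> \<gamma>)(u)\<close>, computed with the
  representative \<open>g x\<close> of each \<open>\<gamma> x\<close>.\<close>

definition left_cop :: "('a \<Rightarrow> 'a \<times> 'a \<Rightarrow>\<^sub>0 int) \<Rightarrow> ('a \<times> 'a \<Rightarrow>\<^sub>0 int) \<Rightarrow> ('a \<times> 'a \<times> 'a \<Rightarrow>\<^sub>0 int)" where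
  "left_cop g u = frag_extend (\<lambda>(x, y). frag_extend (\<lambda>(x1, x2). frag_of (x1, x2, y)) (g x)) u"

definition right_cop :: "('a \<Rightarrow> 'a \<times> 'a \<Rightarrow>\<^sub>0 int) \<Rightarrow> ('a \<times> 'a \<Rightarrow>\<^sub>0 int) \<Rightarrow> ('a \<times> 'a \<times> 'a \<Rightarrow>\<^sub>0 int)" where
  "right_cop g u = frag_extend (\<lambda>(x, y). frag_extend (\<lambda>(y1, y2). frag_of (x, y1, y2)) (g y)) u"

definition tensor_mult ::
  "('a \<times> 'a \<Rightarrow>\<^sub>0 int) \<Rightarrow> ('a \<times> 'a \<Rightarrow>\<^sub>0 int) \<Rightarrow> ('a::times \<times> 'a \<Rightarrow>\<^sub>0 int)" where
  "tensor_mult u v =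
     frag_extend (\<lambda>(x, y). frag_extend (\<lambda>(x', y'). frag_of (x * x', y * y')) v) u"

definition int_mult :: "int \<Rightarrow> 'b::ab_group_add \<Rightarrow> 'b" where
  "int_mult n x = (\<Sum>i<nat n. x) - (\<Sum>i<nat (- n). x)"

text \<open>The counterpart of \<open>frag_extend\<close> for an arbitrary abelian group as target.\<close>

definition lin_extend :: "('x \<Rightarrow> 'b::ab_group_add) \<Rightarrow> ('x \<Rightarrow>\<^sub>0 int) \<Rightarrow> 'b" where
  "lin_extend h u = (\<Sum>x\<in>Poly_Mapping.keys u. int_mult (Poly_Mapping.lookup u x) (h x))"


section \<open>Left bialgebroids and Hopf algebroids\<close>

text \<open>
  \<open>A\<close> is an \<open>L\<close>-\<open>L\<close>-bimodule by \<open>l \<cdot> a \<cdot> l' = s l * t l' * a\<close>; accordingly \<open>A \<otimes>\<^sub>L A\<close> is obtained by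
  identifying \<open>t l * x \<otimes> y\<close> with \<open>x \<otimes> s l * y\<close>.
\<close>

abbreviation relL ::
  "('l \<Rightarrow> 'a::{ring, monoid_mult}) \<Rightarrow> ('l \<Rightarrow> 'a) \<Rightarrow> ('a \<times> 'a \<Rightarrow>\<^sub>0 int) set" where
  "relL s t \<equiv> tensor2_rel (\<lambda>l x. s l * x) (\<lambda>l x. t l * x)"

abbreviation tensorL ::
  "('l \<Rightarrow> 'a::{ring, monoid_mult}) \<Rightarrow> ('l \<Rightarrow> 'a) \<Rightarrow> ('a \<times> 'a \<Rightarrow>\<^sub>0 int) set set" where
  "tensorL s t \<equiv> tensor2 (\<lambda>l x. s l * x) (\<lambda>l x. t l * x)"

abbreviation relL3 ::
  "('l \<Rightarrow> 'a::{ring, monoid_mult}) \<Rightarrow> ('l \<Rightarrow> 'a) \<Rightarrow> ('a \<times> 'a \<times> 'a \<Rightarrow>\<^sub>0 int) set" where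
  "relL3 s t \<equiv> tensor3_rel (\<lambda>l x. s l * x) (\<lambda>l x. t l * x)"

locale left_bialgebroid =
  fixes s :: "'l::{ring, monoid_mult} \<Rightarrow> 'a::{ring, monoid_mult}"
    and t :: "'l \<Rightarrow> 'a"
    and \<gamma> :: "'a \<Rightarrow> ('a \<times> 'a \<Rightarrow>\<^sub>0 int) set"
    and \<pi> :: "'a \<Rightarrow> 'l"
  assumes s_add: "s (l + l') = s l + s l'"
    and s_mult: "s (l * l') = s l * s l'"
    and s_one: "s 1 = 1"
    and t_add: "t (l + l') = t l + t l'"
    and t_mult: "t (l * l') = t l' * t l"
    and t_one: "t 1 = 1"
    and s_t_commute: "s l * t l' = t l' * s l"
    \<comment> \<open>\<open>\<gamma>\<close> and \<open>\<pi>\<close> are \<open>L\<close>-\<open>L\<close>-bimodule maps\<close>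
    and \<gamma>_closed: "\<gamma> a \<in> tensorL s t"
    and \<gamma>_add: "\<gamma> (a + b) = \<gamma> a + \<gamma> b"
    and \<gamma>_left: "u \<in> \<gamma> a \<Longrightarrow>
      \<gamma> (s l * a) = frag_extend (\<lambda>(x, y). frag_of (s l * x, y)) u +o relL s t"
    and \<gamma>_right: "u \<in> \<gamma> a \<Longrightarrow>
      \<gamma> (t l * a) = frag_extend (\<lambda>(x, y). frag_of (x, t l * y)) u +o relL s t"
    and \<pi>_add: "\<pi> (a + b) = \<pi> a + \<pi> b"
    and \<pi>_left: "\<pi> (s l * a) = l * \<pi> a"
    and \<pi>_right: "\<pi> (t l * a) = \<pi> a * l"
    and \<gamma>_coassoc: "(\<And>b. g b \<in> \<gamma> b) \<Longrightarrow>
      left_cop g (g a) +o relL3 s t = right_cop g (g a) +o relL3 s t"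
    and counit_left: "u \<in> \<gamma> a \<Longrightarrow> lin_extend (\<lambda>(x, y). s (\<pi> x) * y) u = a"
    and counit_right: "u \<in> \<gamma> a \<Longrightarrow> lin_extend (\<lambda>(x, y). t (\<pi> y) * x) u = a"
    and \<gamma>_takeuchi: "u \<in> \<gamma> a \<Longrightarrow>
      frag_extend (\<lambda>(x, y). frag_of (x * t l, y)) u +o relL s t =
      frag_extend (\<lambda>(x, y). frag_of (x, y * s l)) u +o relL s t"
    and \<gamma>_one: "\<gamma> 1 = frag_of (1, 1) +o relL s t"
    and \<gamma>_mult: "u \<in> \<gamma> a \<Longrightarrow> v \<in> \<gamma> b \<Longrightarrow> \<gamma> (a * b) = tensor_mult u v +o relL s t"
    and \<pi>_one: "\<pi> 1 = 1"
    and \<pi>_mult_s: "\<pi> (a * s (\<pi> b)) = \<pi> (a * b)"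
    and \<pi>_mult_t: "\<pi> (a * t (\<pi> b)) = \<pi> (a * b)"

definition ring_anti_automorphism :: "('a::{ring, monoid_mult} \<Rightarrow> 'a) \<Rightarrow> bool" where
  "ring_anti_automorphism S \<longleftrightarrow>
     bij S \<and> (\<forall>x y. S (x + y) = S x + S y) \<and> (\<forall>x y. S (x * y) = S y * S x) \<and> S 1 = 1"

locale hopf_algebroid = left_bialgebroid s t \<gamma> \<pi>
  for s :: "'l::{ring, monoid_mult} \<Rightarrow> 'a::{ring, monoid_mult}"
    and t :: "'l \<Rightarrow> 'a"
    and \<gamma> :: "'a \<Rightarrow> ('a \<times> 'a \<Rightarrow>\<^sub>0 int) set"
    and \<pi> :: "'a \<Rightarrow> 'l" +
  fixes S :: "'a \<Rightarrow> 'a"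
  assumes S_anti: "ring_anti_automorphism S"
    and S_t: "S (t l) = s l"
    and inv_S_axiom: "(\<And>b. g b \<in> \<gamma> b) \<Longrightarrow>
      frag_extend (\<lambda>(a1, a2).
        frag_extend (\<lambda>(c1, c2). frag_of (c1, c2 * a1)) (g (inv S a2))) (g a) +o relL s t =
      frag_of (inv S a, 1) +o relL s t"
    and S_axiom: "(\<And>b. g b \<in> \<gamma> b) \<Longrightarrow>
      frag_extend (\<lambda>(a1, a2).
        frag_extend (\<lambda>(c1, c2). frag_of (c1 * a2, c2)) (g (S a1))) (g a) +o relL s t =
      frag_of (1, S a) +o relL s t"


section \<open>Extended Hopf algebras\<close>

locale k_algebra =
  fixes scale :: "'k::{comm_ring, comm_monoid_mult} \<Rightarrow> 'a::{ring, monoid_mult} \<Rightarrow> 'a"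
  assumes scale_add_right: "scale c (x + y) = scale c x + scale c y"
    and scale_add_left: "scale (c + d) x = scale c x + scale d x"
    and scale_scale: "scale c (scale d x) = scale (c * d) x"
    and scale_one: "scale 1 x = x"
    and scale_mult_left: "scale c x * y = scale c (x * y)"
    and scale_mult_right: "x * scale c y = scale c (x * y)"

definition algebra_anti_automorphism ::
  "('k \<Rightarrow> 'a::{ring, monoid_mult} \<Rightarrow> 'a) \<Rightarrow> ('a \<Rightarrow> 'a) \<Rightarrow> bool" where
  "algebra_anti_automorphism scale S \<longleftrightarrow>
     ring_anti_automorphism S \<and> (\<forall>c x. S (scale c x) = scale c (S x))"

text \<open>A \<open>k\<close>-linear coassociative map \<open>A \<rightarrow> A \<otimes>\<^sub>k A\<close>; no counit is required.\<close>

locale coassociative_coproduct = k_algebra scale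
  for scale :: "'k::{comm_ring, comm_monoid_mult} \<Rightarrow> 'a::{ring, monoid_mult} \<Rightarrow> 'a" +
  fixes \<Delta> :: "'a \<Rightarrow> ('a \<times> 'a \<Rightarrow>\<^sub>0 int) set"
  assumes \<Delta>_closed: "\<Delta> a \<in> tensor2 scale scale"
    and \<Delta>_add: "\<Delta> (a + b) = \<Delta> a + \<Delta> b"
    and \<Delta>_scale: "u \<in> \<Delta> a \<Longrightarrow>
      \<Delta> (scale c a) =
        frag_extend (\<lambda>(x, y). frag_of (scale c x, y)) u +o tensor2_rel scale scale"
    and \<Delta>_coassoc: "(\<And>b. d b \<in> \<Delta> b) \<Longrightarrow>
      left_cop d (d a) +o tensor3_rel scale scale = right_cop d (d a) +o tensor3_rel scale scale"

text \<open>
  The canonical projection \<open>p\<^sub>L : A \<otimes>\<^sub>k A \<rightarrow> A \<otimes>\<^sub>L A\<close> sends a coset \<open>X\<close> of the \<open>k\<close>-relations to the coset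
  of the \<open>L\<close>-relations containing it, which is the sum of sets \<open>X + relL s t\<close>.  As \<open>\<gamma> a\<close> is a
  single coset of \<open>relL s t\<close>, \<open>\<gamma> a = \<Delta> a + relL s t\<close> entails that the \<open>k\<close>-relations are contained in
  \<open>relL s t\<close>, i.e. that \<open>p\<^sub>L\<close> is well defined.
\<close>

locale extended_hopf_algebra =
  left_bialgebroid s t \<gamma> \<pi> +
  A: coassociative_coproduct scaleA \<Delta> +
  L: k_algebra scaleL
  for scaleA :: "'k::{comm_ring, comm_monoid_mult} \<Rightarrow> 'a::{ring, monoid_mult} \<Rightarrow> 'a"
    and scaleL :: "'k \<Rightarrow> 'l::{ring, monoid_mult} \<Rightarrow> 'l"
    and s t :: "'l \<Rightarrow> 'a"
    and \<gamma> :: "'a \<Rightarrow> ('a \<times> 'a \<Rightarrow>\<^sub>0 int) set"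
    and \<pi> :: "'a \<Rightarrow> 'l"
    and \<Delta> :: "'a \<Rightarrow> ('a \<times> 'a \<Rightarrow>\<^sub>0 int) set" +
  fixes S S' :: "'a \<Rightarrow> 'a"
  assumes S_anti: "algebra_anti_automorphism scaleA S"
    and S'_anti: "algebra_anti_automorphism scaleA S'"
    and S'_S': "S' \<circ> S' = id"
    and S_t: "S \<circ> t = s"
    and S'_t: "S' \<circ> t = s"
    and S_antipode: "u \<in> \<gamma> a \<Longrightarrow> lin_extend (\<lambda>(a1, a2). S a1 * a2) u = t (\<pi> (S a))"
    and S'_antipode: "u \<in> \<gamma> a \<Longrightarrow> lin_extend (\<lambda>(a1, a2). S' a1 * a2) u = t (\<pi> (S' a))"
    and \<gamma>_\<Delta>: "\<gamma> a = \<Delta> a + relL s t"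
    and \<Delta>_S: "u \<in> \<Delta> a \<Longrightarrow>
      \<Delta> (S a) = frag_extend (\<lambda>(a1, a2). frag_of (S a2, S a1)) u +o tensor2_rel scaleA scaleA"
    and \<Delta>_S': "u \<in> \<Delta> a \<Longrightarrow>
      \<Delta> (S' a) = frag_extend (\<lambda>(a1, a2). frag_of (S a2, S' a1)) u +o tensor2_rel scaleA scaleA"

end

theory Submission
  imports Defs
begin

text \<open>
  Choose representatives of \<open>\<Delta>\<close> instead of \<open>\<gamma>\<close>; this is harmless because the left-hand sides of the
  Hopf algebroid axioms are \<open>L\<close>-balanced in \<open>a\<^sub>(\<^sub>1\<^sub>) \<otimes> a\<^sub>(\<^sub>2\<^sub>)\<close>, by multiplicativity of \<open>\<gamma>\<close> and the bimodule
  axioms. Write \<open>\<Delta> a = a\<^sub>1 \<otimes> a\<^sub>2\<close>. As \<open>\<Delta> (S' b) = S b\<^sub>2 \<otimes> S' b\<^sub>1\<close>, coassociativity over \<open>k\<close> turns the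
  left-hand side of the second axiom into \<open>S a\<^sub>2 a\<^sub>3 \<otimes> S' a\<^sub>1 = t (\<pi> (S a\<^sub>2)) \<otimes> S' a\<^sub>1\<close>, which equals
  \<open>1 \<otimes> s (\<pi> (S a\<^sub>2)) S' a\<^sub>1 = 1 \<otimes> S' a\<close> by the counit law for \<open>S' a\<close>. Likewise the first axiom reads
  \<open>S a\<^sub>3 \<otimes> S' a\<^sub>2 a\<^sub>1 = S' a \<otimes> 1\<close>, where \<open>S' a\<^sub>2 a\<^sub>1 = s (\<pi> (S' a))\<close> is the image under \<open>S'\<close> of the antipode
  identity for \<open>S'\<close>.
\<close>

section \<open>Formal sums\<close>

lemma frag_extend_frag_extend:
  "frag_extend f (frag_extend g u) = frag_extend (\<lambda>x. frag_extend f (g x)) u"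
  using subset_UNIV by (induction u rule: frag_induction) (auto simp: frag_extend_diff)

lemma frag_extend_diff_fun:
  "frag_extend (\<lambda>x. f x - g x) u = frag_extend f u - frag_extend g u"
  using subset_UNIV by (induction u rule: frag_induction) (auto simp: frag_extend_diff algebra_simps)

lemma frag_extend_in_group_closure:
  assumes "\<And>x. f x \<in> group_closure H"
  shows "frag_extend f u \<in> group_closure H"
  using subset_UNIV
  by (induction u rule: frag_induction) (auto simp: frag_extend_diff assms intro: group_closure.diff)

lemma frag_extend_group_closure:
  assumes "u \<in> group_closure G" "\<And>x. x \<in> G \<Longrightarrow> frag_extend f x \<in> group_closure H"
  shows "frag_extend f u \<in> group_closure H"
  using assms(1)
  by (induction rule: group_closure.induct) (auto simp: frag_extend_diff assms(2) intro: group_closure.diff)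

text \<open>The universal property of the tensor product: as \<open>frag_extend f\<close> is a
  homomorphism, a check on the generating relations suffices.\<close>

lemma tensor2_rel_frag_extend:
  assumes u: "u \<in> tensor2_rel lact ract"
    and "\<And>x x' y. f (x + x', y) - f (x, y) - f (x', y) \<in> tensor2_rel lact' ract'"
    and "\<And>x y y'. f (x, y + y') - f (x, y) - f (x, y') \<in> tensor2_rel lact' ract'"
    and "\<And>r x y. f (ract r x, y) - f (x, lact r y) \<in> tensor2_rel lact' ract'"
  shows "frag_extend f u \<in> tensor2_rel lact' ract'"
proof -
  obtain H where H: "tensor2_rel lact' ract' = group_closure H"
    unfolding tensor2_rel_def by blast
  show ?thesis
    using u unfolding H tensor2_rel_def[of lact ract]
    by (rule frag_extend_group_closure) (auto simp: frag_extend_diff assms(2-4)[unfolded H])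
qed

text \<open>The target is twofold because coassociativity is only used after mapping triples to
  pairs.\<close>

lemma tensor3_rel_frag_extend:
  assumes u: "u \<in> tensor3_rel lact ract"
    and "\<And>x x' y z. f (x + x', y, z) - f (x, y, z) - f (x', y, z) \<in> tensor2_rel lact' ract'"
    and "\<And>x y y' z. f (x, y + y', z) - f (x, y, z) - f (x, y', z) \<in> tensor2_rel lact' ract'"
    and "\<And>x y z z'. f (x, y, z + z') - f (x, y, z) - f (x, y, z') \<in> tensor2_rel lact' ract'"
    and "\<And>r x y z. f (ract r x, y, z) - f (x, lact r y, z) \<in> tensor2_rel lact' ract'"
    and "\<And>r x y z. f (x, ract r y, z) - f (x, y, lact r z) \<in> tensor2_rel lact' ract'"
  shows "frag_extend f u \<in> tensor2_rel lact' ract'"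
proof -
  obtain H where H: "tensor2_rel lact' ract' = group_closure H"
    unfolding tensor2_rel_def by blast
  show ?thesis
    using u unfolding H tensor3_rel_def
    by (rule frag_extend_group_closure) (auto simp: frag_extend_diff assms(2-6)[unfolded H])
qed

section \<open>Congruence modulo the tensor relations\<close>

lemma tensor2_rel_zero [simp]: "0 \<in> tensor2_rel lact ract"
  by (simp add: tensor2_rel_def)

lemma tensor2_rel_diff: "u \<in> tensor2_rel lact ract \<Longrightarrow> v \<in> tensor2_rel lact ract \<Longrightarrow>
    u - v \<in> tensor2_rel lact ract"
  unfolding tensor2_rel_def by (rule group_closure.diff)

lemma tensor2_rel_add: "u \<in> tensor2_rel lact ract \<Longrightarrow> v \<in> tensor2_rel lact ract \<Longrightarrow>
    u + v \<in> tensor2_rel lact ract"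
  unfolding tensor2_rel_def by (rule group_closure_add)

lemma tensor2_rel_trans: "u - v \<in> tensor2_rel lact ract \<Longrightarrow> v - w \<in> tensor2_rel lact ract \<Longrightarrow>
    u - w \<in> tensor2_rel lact ract"
  using tensor2_rel_add[of "u - v" _ _ "v - w"] by simp

lemma frag_extend_in_tensor2_rel:
  assumes "\<And>x. f x \<in> tensor2_rel lact ract"
  shows "frag_extend f u \<in> tensor2_rel lact ract"
  using assms unfolding tensor2_rel_def by (rule frag_extend_in_group_closure)

lemma frag_extend_cong_tensor2_rel:
  assumes "\<And>x. f x - g x \<in> tensor2_rel lact ract"
  shows "frag_extend f u - frag_extend g u \<in> tensor2_rel lact ract"
  using frag_extend_in_tensor2_rel[OF assms] by (simp add: frag_extend_diff_fun)

lemma tensor2_rel_left: "frag_of (x + x', y) - frag_of (x, y) - frag_of (x', y) \<in> tensor2_rel lact ract"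
  unfolding tensor2_rel_def by (rule group_closure.base) blast

lemma tensor2_rel_right: "frag_of (x, y + y') - frag_of (x, y) - frag_of (x, y') \<in> tensor2_rel lact ract"
  unfolding tensor2_rel_def by (rule group_closure.base) blast

lemma tensor2_rel_balanced: "frag_of (ract r x, y) - frag_of (x, lact r y) \<in> tensor2_rel lact ract"
  unfolding tensor2_rel_def by (rule group_closure.base) blast

lemma mem_coset_iff:
  fixes a b :: "'b::ab_group_add"
  shows "a \<in> b +o R \<longleftrightarrow> a - b \<in> R"
  by (simp add: set_minus_plus)

text \<open>The bridge from the axioms, which equate cosets, to membership of differences, which can
  be chained by \<open>tensor2_rel_trans\<close>.\<close>

lemma tensor2_rel_coset_eq_iff:
  "u +o tensor2_rel lact ract = v +o tensor2_rel lact ract \<longleftrightarrow> u - v \<in> tensor2_rel lact ract"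
proof
  assume "u +o tensor2_rel lact ract = v +o tensor2_rel lact ract"
  moreover have "u \<in> u +o tensor2_rel lact ract"
    by (simp add: mem_coset_iff)
  ultimately show "u - v \<in> tensor2_rel lact ract"
    by (simp add: mem_coset_iff)
next
  assume uv: "u - v \<in> tensor2_rel lact ract"
  show "u +o tensor2_rel lact ract = v +o tensor2_rel lact ract"
  proof (intro set_eqI)
    fix w
    have "w - v = (w - u) + (u - v)" "w - u = (w - v) - (u - v)"
      by simp_all
    then show "w \<in> u +o tensor2_rel lact ract \<longleftrightarrow> w \<in> v +o tensor2_rel lact ract"
      using uv by (metis mem_coset_iff tensor2_rel_add tensor2_rel_diff)
  qed
qed

lemma tensor3_rel_coset_eqD:
  assumes "u +o tensor3_rel lact ract = v +o tensor3_rel lact ract"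
  shows "u - v \<in> tensor3_rel lact ract"
proof -
  have "u \<in> u +o tensor3_rel lact ract"
    by (simp add: mem_coset_iff tensor3_rel_def)
  with assms show ?thesis
    by (simp add: mem_coset_iff)
qed

section \<open>Integer multiples and linear extension\<close>

lemma int_mult_zero [simp]: "int_mult 0 x = 0"
  and int_mult_one [simp]: "int_mult 1 x = x"
  by (simp_all add: int_mult_def)

lemma int_mult_plus_one: "int_mult (n + 1) x = int_mult n x + x"
proof (cases "n \<ge> 0")
  case True
  then have "nat (n + 1) = Suc (nat n)" "nat (- n) = 0" "nat (- (n + 1)) = 0"
    by simp_all
  then show ?thesis
    by (simp add: int_mult_def)
next
  case False
  \<comment> \<open>Since \<open>n + 1 \<le> 0\<close>, even at \<open>n = -1\<close> the positive
    sum stays empty and the negative sum loses one term.\<close>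
  then have "nat (- n) = Suc (nat (- (n + 1)))" "nat n = 0" "nat (n + 1) = 0"
    by simp_all
  then show ?thesis
    by (simp add: int_mult_def)
qed

lemma int_mult_add: "int_mult (m + n) x = int_mult m x + int_mult n x"
proof (induction n rule: int_induct[where k = 0])
  case (step1 i)
  then show ?case
    using int_mult_plus_one[of "m + i" x] int_mult_plus_one[of i x] by (simp add: add.assoc)
next
  case (step2 i)
  then show ?case
    using int_mult_plus_one[of "m + (i - 1)" x] int_mult_plus_one[of "i - 1" x]
    by (simp add: algebra_simps)
qed simp

lemma int_mult_diff: "int_mult (m - n) x = int_mult m x - int_mult n x"
  using int_mult_add[of "m - n" n x] by (simp add: algebra_simps)

lemma lin_extend_superset:
  assumes "finite K" "Poly_Mapping.keys u \<subseteq> K"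
  shows "lin_extend h u = (\<Sum>x\<in>K. int_mult (Poly_Mapping.lookup u x) (h x))"
  unfolding lin_extend_def using assms
  by (intro sum.mono_neutral_left) (auto simp: in_keys_iff)

lemma lin_extend_0 [simp]: "lin_extend h 0 = 0"
  and lin_extend_of [simp]: "lin_extend h (frag_of x) = h x"
  by (simp_all add: lin_extend_def)

lemma lin_extend_diff: "lin_extend h (u - v) = lin_extend h u - lin_extend h v"
proof -
  let ?K = "Poly_Mapping.keys u \<union> Poly_Mapping.keys v"
  have "Poly_Mapping.keys (u - v) \<subseteq> ?K"
    by (auto simp: in_keys_iff lookup_minus)
  then show ?thesis
    by (simp add: lin_extend_superset[of ?K] lookup_minus int_mult_diff sum_subtractf)
qed

lemma lin_extend_frag_extend:
  "lin_extend h (frag_extend f u) = lin_extend (\<lambda>x. lin_extend h (f x)) u"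
  using subset_UNIV by (induction u rule: frag_induction) (auto simp: frag_extend_diff lin_extend_diff)

lemma additive_lin_extend:
  fixes F :: "'b::ab_group_add \<Rightarrow> 'c::ab_group_add"
  assumes add: "\<And>x y. F (x + y) = F x + F y"
  shows "F (lin_extend h u) = lin_extend (\<lambda>x. F (h x)) u"
proof -
  have zero: "F 0 = 0"
    using add[of 0 0] by simp
  have diff: "F (x - y) = F x - F y" for x y
    using add[of "x - y" y] by simp
  show ?thesis
    using subset_UNIV by (induction u rule: frag_induction) (auto simp: lin_extend_diff zero diff)
qed

section \<open>Collecting a formal sum into one pure tensor\<close>

lemma frag_of_zero_right: "frag_of (x, 0) \<in> tensor2_rel lact ract"
  \<comment> \<open>The additivity relation at \<open>0 + 0\<close> is
    \<open>- frag_of (x, 0)\<close>.\<close>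
  using tensor2_rel_diff[OF tensor2_rel_zero tensor2_rel_right[of x 0 0 lact ract]] by simp

lemma frag_of_zero_left: "frag_of (0, y) \<in> tensor2_rel lact ract"
  using tensor2_rel_diff[OF tensor2_rel_zero tensor2_rel_left[of 0 0 y lact ract]] by simp

lemma frag_of_diff_right:
  "frag_of (x, y - y') - (frag_of (x, y) - frag_of (x, y')) \<in> tensor2_rel lact ract"
  using tensor2_rel_diff[OF tensor2_rel_zero tensor2_rel_right[of x "y - y'" y' lact ract]]
  by (simp add: algebra_simps)

lemma frag_of_diff_left:
  "frag_of (x - x', y) - (frag_of (x, y) - frag_of (x', y)) \<in> tensor2_rel lact ract"
  using tensor2_rel_diff[OF tensor2_rel_zero tensor2_rel_left[of "x - x'" x' y lact ract]]
  by (simp add: algebra_simps)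

text \<open>Additivity of the second factor gathers the sum. In this way the antipode and counit
  identities, which are sums in \<open>A\<close>, can be applied inside a tensor.\<close>

lemma frag_extend_frag_of_right:
  "frag_extend (\<lambda>p. frag_of (x, h p)) u - frag_of (x, lin_extend h u) \<in> tensor2_rel lact ract"
  using subset_UNIV
proof (induction u rule: frag_induction)
  case zero
  then show ?case
    using tensor2_rel_diff[OF tensor2_rel_zero frag_of_zero_right] by simp
next
  case (diff u v)
  from tensor2_rel_diff[OF tensor2_rel_diff[OF diff.IH]
      frag_of_diff_right[of x "lin_extend h u" "lin_extend h v"]]
  show ?case
    by (simp add: frag_extend_diff lin_extend_diff algebra_simps)
qed simp

lemma frag_extend_frag_of_left:
  "frag_extend (\<lambda>p. frag_of (h p, y)) u - frag_of (lin_extend h u, y) \<in> tensor2_rel lact ract"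
  using subset_UNIV
proof (induction u rule: frag_induction)
  case zero
  then show ?case
    using tensor2_rel_diff[OF tensor2_rel_zero frag_of_zero_left] by simp
next
  case (diff u v)
  from tensor2_rel_diff[OF tensor2_rel_diff[OF diff.IH]
      frag_of_diff_left[of "lin_extend h u" "lin_extend h v" y]]
  show ?case
    by (simp add: frag_extend_diff lin_extend_diff algebra_simps)
qed simp

section \<open>The Hopf algebroid axioms\<close>

context left_bialgebroid
begin

lemma \<gamma>_diff_in_relL:
  assumes "u \<in> \<gamma> a" "v \<in> \<gamma> a"
  shows "u - v \<in> relL s t"
proof -
  obtain w where "\<gamma> a = w +o relL s t"
    using \<gamma>_closed[of a] by (auto simp: tensor2_def)
  with assms have "(u - w) - (v - w) \<in> relL s t"
    by (simp only: mem_coset_iff tensor2_rel_diff)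
  then show ?thesis
    by simp
qed

text \<open>By \<open>\<gamma>_left\<close> at 1, the pair \<open>(s l, 1)\<close> represents
  \<open>\<gamma> (s l)\<close>; multiplicativity of \<open>\<gamma>\<close> does the rest.\<close>

lemma \<gamma>_mult_s:
  assumes "u \<in> \<gamma> a"
  shows "\<gamma> (a * s l) = frag_extend (\<lambda>(x, y). frag_of (x * s l, y)) u +o relL s t"
proof -
  have "frag_of (1, 1) \<in> \<gamma> 1"
    by (simp add: \<gamma>_one mem_coset_iff)
  from \<gamma>_left[OF this, of l] have "frag_of (s l, 1) \<in> \<gamma> (s l)"
    by (simp add: mem_coset_iff)
  from \<gamma>_mult[OF assms this] show ?thesis
    by (simp add: tensor_mult_def)
qed

lemma \<gamma>_mult_t:
  assumes "u \<in> \<gamma> a"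
  shows "\<gamma> (a * t l) = frag_extend (\<lambda>(x, y). frag_of (x, y * t l)) u +o relL s t"
proof -
  have "frag_of (1, 1) \<in> \<gamma> 1"
    by (simp add: \<gamma>_one mem_coset_iff)
  from \<gamma>_right[OF this, of l] have "frag_of (1, t l) \<in> \<gamma> (t l)"
    by (simp add: mem_coset_iff)
  from \<gamma>_mult[OF assms this] show ?thesis
    by (simp add: tensor_mult_def)
qed

lemma relL_balanced: "frag_of (t l * x, y) - frag_of (x, s l * y) \<in> relL s t"
  by (rule tensor2_rel_balanced)

text \<open>Right multiplication commutes with the left multiplications by \<open>t l\<close> and
  \<open>s l\<close> that define the relations, so it descends to the tensor product.\<close>

lemma relL_mult_left:
  assumes "u \<in> relL s t"
  shows "frag_extend (\<lambda>(x, y). frag_of (x * c, y)) u \<in> relL s t"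
  using assms
  by (rule tensor2_rel_frag_extend)
    (use relL_balanced in \<open>simp_all add: distrib_right mult.assoc tensor2_rel_left tensor2_rel_right\<close>)

lemma relL_mult_right:
  assumes "u \<in> relL s t"
  shows "frag_extend (\<lambda>(x, y). frag_of (x, y * c)) u \<in> relL s t"
  using assms
  by (rule tensor2_rel_frag_extend)
    (use relL_balanced in \<open>simp_all add: distrib_right mult.assoc tensor2_rel_left tensor2_rel_right\<close>)

end

section \<open>The coproduct over \<open>k\<close> and the two anti-automorphisms\<close>

context extended_hopf_algebra
begin

text \<open>\<open>\<Delta> 1\<close> is a full coset of the \<open>k\<close>-relations and lies in
  the single coset \<open>\<gamma> 1\<close>; differences of its members give every
  \<open>k\<close>-relation.\<close>

lemma relk_subset_relL: "tensor2_rel scaleA scaleA \<subseteq> relL s t"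
proof
  fix r assume r: "r \<in> tensor2_rel scaleA scaleA"
  obtain w where w: "\<gamma> 1 = w +o relL s t"
    using \<gamma>_closed[of 1] by (auto simp: tensor2_def)
  obtain v where v: "\<Delta> 1 = v +o tensor2_rel scaleA scaleA"
    using A.\<Delta>_closed[of 1] by (auto simp: tensor2_def)
  have "x \<in> w +o relL s t" if "x \<in> \<Delta> 1" for x
    using set_plus_intro[OF that tensor2_rel_zero] \<gamma>_\<Delta>[of 1] w by simp
  with v r have "v + r - w \<in> relL s t" "v - w \<in> relL s t"
    by (simp_all add: mem_coset_iff)
  from tensor2_rel_diff[OF this] show "r \<in> relL s t"
    by simp
qed

lemma \<Delta>_subset_\<gamma>: "u \<in> \<Delta> a \<Longrightarrow> u \<in> \<gamma> a"
  using set_plus_intro[OF _ tensor2_rel_zero] \<gamma>_\<Delta>[of a] by fastforce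

lemma obtain_\<Delta>_representatives:
  obtains d where "\<And>b. d b \<in> \<Delta> b"
proof -
  have "\<exists>v. v \<in> \<Delta> b" for b
  proof -
    obtain v where "\<Delta> b = v +o tensor2_rel scaleA scaleA"
      using A.\<Delta>_closed[of b] by (auto simp: tensor2_def)
    then have "v \<in> \<Delta> b"
      by (simp add: mem_coset_iff)
    then show ?thesis ..
  qed
  then show ?thesis
    using that by metis
qed

lemma scale_balanced: "frag_of (scaleA c x, y) - frag_of (x, scaleA c y) \<in> relL s t"
  using relk_subset_relL tensor2_rel_balanced[of scaleA c x y scaleA] by blast

lemma S_add: "S (x + y) = S x + S y"
  and S_scale: "S (scaleA c x) = scaleA c (S x)"
  using S_anti by (auto simp: algebra_anti_automorphism_def ring_anti_automorphism_def)

lemma S'_add: "S' (x + y) = S' x + S' y"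
  and S'_mult: "S' (x * y) = S' y * S' x"
  and S'_scale: "S' (scaleA c x) = scaleA c (S' x)"
  and ring_anti_automorphism_S': "ring_anti_automorphism S'"
  using S'_anti by (auto simp: algebra_anti_automorphism_def ring_anti_automorphism_def)

lemma S'_S'_apply [simp]: "S' (S' x) = x"
  using fun_cong[OF S'_S', of x] by simp

lemma S'_t_apply [simp]: "S' (t l) = s l"
  using fun_cong[OF S'_t, of l] by simp

lemma S'_s [simp]: "S' (s l) = t l"
  by (simp flip: S'_t_apply)

lemma inv_S': "inv S' = S'"
  by (rule inv_equality) simp_all

text \<open>Supplies an explicit representative to put in place of an arbitrary
  \<open>g (S' a)\<close>.\<close>

lemma S_S'_mem_\<gamma>:
  assumes "u \<in> \<Delta> a"
  shows "frag_extend (\<lambda>(x, y). frag_of (S y, S' x)) u \<in> \<gamma> (S' a)"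
  using \<Delta>_S'[OF assms] by (intro \<Delta>_subset_\<gamma>) (simp add: mem_coset_iff tensor2_rel_def)

text \<open>Applying the involutive anti-automorphism \<open>S'\<close> to its antipode identity
  turns \<open>S' x * y\<close> into \<open>S' y * x\<close> and \<open>t\<close> into
  \<open>s\<close>.\<close>

lemma S'_antipode_twisted:
  assumes "u \<in> \<gamma> a"
  shows "lin_extend (\<lambda>(x, y). S' y * x) u = s (\<pi> (S' a))"
proof -
  have "S' (lin_extend (\<lambda>(x, y). S' x * y) u) = lin_extend (\<lambda>(x, y). S' y * x) u"
    by (subst additive_lin_extend[of S']) (simp_all add: S'_add S'_mult case_prod_unfold)
  with S'_antipode[OF assms] show ?thesis
    by simp
qed

text \<open>A choice \<open>g\<close> of representatives inherits additivity from
  \<open>\<gamma>\<close> only modulo the relations.\<close>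

lemma coproduct_rep_add:
  assumes "\<And>b. g b \<in> \<gamma> b"
  shows "g (x + y) - g x - g y \<in> relL s t"
  using \<gamma>_diff_in_relL[OF assms, of "g x + g y" "x + y"] set_plus_intro[OF assms assms, of x y]
  by (simp add: \<gamma>_add diff_diff_eq)

text \<open>The axiom for \<open>inv S'\<close>, which is \<open>S'\<close> itself. Five congruences
  are chained: change of outer representative, change of inner representatives, coassociativity,
  antipode identity, counit law.\<close>

lemma inv_antipode_axiom:
  assumes g: "\<And>b. g b \<in> \<gamma> b"
  shows "frag_extend (\<lambda>(a1, a2).
      frag_extend (\<lambda>(c1, c2). frag_of (c1, c2 * a1)) (g (S' a2))) (g a) - frag_of (S' a, 1) \<in> relL s t"
proof -
  obtain d where d: "\<And>b. d b \<in> \<Delta> b"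
    using obtain_\<Delta>_representatives by blast
  \<comment> \<open>The inner sum of the goal is \<open>M a1 (g (S' a2))\<close>; \<open>h\<close>
    sends either bracketing of the iterated \<open>\<Delta>\<close> to pairs.\<close>
  define M where "M c = frag_extend (\<lambda>(x, y). frag_of (x :: 'a, y * c))" for c :: 'a
  define h where "h = (\<lambda>(x, y, z). frag_of (S z, S' y * x))"
  have M_diff: "M c (u - v) = M c u - M c v" for c u v
    by (simp add: M_def frag_extend_diff)
  have M_relL: "M c u \<in> relL s t" if "u \<in> relL s t" for c u
    unfolding M_def using that by (rule relL_mult_right)
  have M_mult: "M c (M b u) = M (b * c) u" for b c u
    by (simp add: M_def frag_extend_frag_extend case_prod_unfold mult.assoc)
  have "frag_extend (\<lambda>(x, y). M x (g (S' y))) (g a - d a) \<in> relL s t"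
  proof (rule tensor2_rel_frag_extend[OF \<gamma>_diff_in_relL[OF g \<Delta>_subset_\<gamma>[OF d]]])
    fix x x' y
    have "M (x + x') u - M x u - M x' u
        = frag_extend (\<lambda>(p, q). frag_of (p, q * (x + x')) - frag_of (p, q * x) - frag_of (p, q * x')) u" for u
      by (simp add: M_def case_prod_unfold frag_extend_diff_fun)
    also have "\<dots> u \<in> relL s t" for u
      by (rule frag_extend_in_tensor2_rel) (auto simp: distrib_left tensor2_rel_right)
    finally show "(\<lambda>(x, y). M x (g (S' y))) (x + x', y) - (\<lambda>(x, y). M x (g (S' y))) (x, y)
        - (\<lambda>(x, y). M x (g (S' y))) (x', y) \<in> relL s t"
      by simp
  next
    fix x y y'
    show "(\<lambda>(x, y). M x (g (S' y))) (x, y + y') - (\<lambda>(x, y). M x (g (S' y))) (x, y)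
        - (\<lambda>(x, y). M x (g (S' y))) (x, y') \<in> relL s t"
      using M_relL[OF coproduct_rep_add[OF g, of "S' y" "S' y'"]]
      by (simp add: S'_add M_diff)
  next
    fix l x y
    \<comment> \<open>Balance over \<open>L\<close> rests on
      \<open>S' (s l * y) = S' y * t l\<close>.\<close>
    have "M (t l) (g (S' y)) \<in> \<gamma> (S' y * t l)"
      unfolding \<gamma>_mult_t[OF g] by (simp add: M_def mem_coset_iff)
    from M_relL[OF \<gamma>_diff_in_relL[OF this g], of x]
    have "M (t l * x) (g (S' y)) - M x (g (S' (s l * y))) \<in> relL s t"
      by (simp add: M_diff M_mult S'_mult)
    then show "(\<lambda>(x, y). M x (g (S' y))) (t l * x, y) - (\<lambda>(x, y). M x (g (S' y))) (x, s l * y) \<in> relL s t"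
      by simp
  qed
  then have "frag_extend (\<lambda>(x, y). M x (g (S' y))) (g a) - frag_extend (\<lambda>(x, y). M x (g (S' y))) (d a)
      \<in> relL s t"
    by (simp add: frag_extend_diff)
  moreover have "frag_extend (\<lambda>(x, y). M x (g (S' y))) (d a) - frag_extend h (right_cop d (d a)) \<in> relL s t"
  proof -
    have "frag_extend h (right_cop d (d a))
        = frag_extend (\<lambda>(x, y). M x (frag_extend (\<lambda>(x, y). frag_of (S y, S' x)) (d y))) (d a)"
      by (simp add: right_cop_def h_def M_def frag_extend_frag_extend case_prod_unfold)
    moreover have "M x (g (S' y)) - M x (frag_extend (\<lambda>(x, y). frag_of (S y, S' x)) (d y)) \<in> relL s t" for x y
      using M_relL[OF \<gamma>_diff_in_relL[OF g S_S'_mem_\<gamma>[OF d]]] by (simp add: M_diff)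
    ultimately show ?thesis
      by (auto intro!: frag_extend_cong_tensor2_rel)
  qed
  moreover have "frag_extend h (right_cop d (d a)) - frag_extend h (left_cop d (d a)) \<in> relL s t"
  proof -
    have "right_cop d (d a) - left_cop d (d a) \<in> tensor3_rel scaleA scaleA"
      using tensor3_rel_coset_eqD A.\<Delta>_coassoc[OF d] by metis
    then have "frag_extend h (right_cop d (d a) - left_cop d (d a)) \<in> relL s t"
      \<comment> \<open>By \<open>k\<close>-linearity of \<open>S\<close> and \<open>S'\<close>,
        \<open>h\<close> respects the relations; it reverses the order of the factors, so
        \<open>scale_balanced\<close> is also needed with the opposite sign.\<close>
      by (rule tensor3_rel_frag_extend)
        (simp_all add: h_def S_add S'_add S_scale S'_scale distrib_left distrib_right tensor2_rel_left
          tensor2_rel_right A.scale_mult_left A.scale_mult_right scale_balanced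
          tensor2_rel_diff[OF tensor2_rel_zero scale_balanced, simplified])
    then show ?thesis
      by (simp add: frag_extend_diff)
  qed
  moreover have "frag_extend h (left_cop d (d a)) - frag_extend (\<lambda>(x, y). frag_of (t (\<pi> (S' x)) * S y, 1)) (d a)
      \<in> relL s t"
  proof -
    have "frag_extend (\<lambda>(p, q). frag_of (S y, S' q * p)) (d x) - frag_of (t (\<pi> (S' x)) * S y, 1) \<in> relL s t"
      for x y
    proof (rule tensor2_rel_trans)
      show "frag_extend (\<lambda>(p, q). frag_of (S y, S' q * p)) (d x) - frag_of (S y, s (\<pi> (S' x))) \<in> relL s t"
        using frag_extend_frag_of_right[of "S y" "\<lambda>(p, q). S' q * p" "d x" "\<lambda>l x. s l * x" "\<lambda>l x. t l * x"]
        by (simp add: S'_antipode_twisted[OF \<Delta>_subset_\<gamma>[OF d], unfolded case_prod_unfold] case_prod_unfold)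
      \<comment> \<open>Reading the second factor as \<open>s (\<pi> (S' x)) * 1\<close> lets the
        scalar cross the tensor sign.\<close>
      show "frag_of (S y, s (\<pi> (S' x))) - frag_of (t (\<pi> (S' x)) * S y, 1) \<in> relL s t"
        using tensor2_rel_diff[OF tensor2_rel_zero relL_balanced[of "\<pi> (S' x)" "S y" 1]] by simp
    qed
    moreover have "frag_extend h (left_cop d (d a))
        = frag_extend (\<lambda>(x, y). frag_extend (\<lambda>(p, q). frag_of (S y, S' q * p)) (d x)) (d a)"
      by (simp add: left_cop_def h_def frag_extend_frag_extend case_prod_unfold)
    ultimately show ?thesis
      by (auto intro!: frag_extend_cong_tensor2_rel)
  qed
  moreover have "frag_extend (\<lambda>(x, y). frag_of (t (\<pi> (S' x)) * S y, 1)) (d a) - frag_of (S' a, 1) \<in> relL s t"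
  proof -
    have "lin_extend (\<lambda>(x, y). t (\<pi> (S' x)) * S y) (d a) = S' a"
      \<comment> \<open>The counit law is evaluated at the representative
        \<open>S y \<otimes> S' x\<close> of \<open>\<gamma> (S' a)\<close>.\<close>
      using counit_right[OF S_S'_mem_\<gamma>[OF d, of a]]
      by (simp add: lin_extend_frag_extend case_prod_unfold)
    with frag_extend_frag_of_left[of "\<lambda>(x, y). t (\<pi> (S' x)) * S y" 1 "d a" "\<lambda>l x. s l * x" "\<lambda>l x. t l * x"]
    show ?thesis
      by (simp add: case_prod_unfold)
  qed
  ultimately show ?thesis
    unfolding M_def by (blast intro: tensor2_rel_trans)
qed

text \<open>Mirrors the previous chain with the bracketings exchanged. As \<open>S\<close> stands in
  the first factor of \<open>\<Delta> (S' b)\<close>, which is the factor now multiplied, the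
  antipode identity of \<open>S\<close> is the one that appears.\<close>

lemma antipode_axiom:
  assumes g: "\<And>b. g b \<in> \<gamma> b"
  shows "frag_extend (\<lambda>(a1, a2).
      frag_extend (\<lambda>(c1, c2). frag_of (c1 * a2, c2)) (g (S' a1))) (g a) - frag_of (1, S' a) \<in> relL s t"
proof -
  obtain d where d: "\<And>b. d b \<in> \<Delta> b"
    using obtain_\<Delta>_representatives by blast
  define M where "M c = frag_extend (\<lambda>(x, y). frag_of (x * c, y :: 'a))" for c :: 'a
  define h where "h = (\<lambda>(x, y, z). frag_of (S y * z, S' x))"
  have M_diff: "M c (u - v) = M c u - M c v" for c u v
    by (simp add: M_def frag_extend_diff)
  have M_relL: "M c u \<in> relL s t" if "u \<in> relL s t" for c u
    unfolding M_def using that by (rule relL_mult_left)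
  have M_mult: "M c (M b u) = M (b * c) u" for b c u
    by (simp add: M_def frag_extend_frag_extend case_prod_unfold mult.assoc)
  have "frag_extend (\<lambda>(x, y). M y (g (S' x))) (g a - d a) \<in> relL s t"
  proof (rule tensor2_rel_frag_extend[OF \<gamma>_diff_in_relL[OF g \<Delta>_subset_\<gamma>[OF d]]])
    fix x y y'
    have "M (y + y') u - M y u - M y' u
        = frag_extend (\<lambda>(p, q). frag_of (p * (y + y'), q) - frag_of (p * y, q) - frag_of (p * y', q)) u" for u
      by (simp add: M_def case_prod_unfold frag_extend_diff_fun)
    also have "\<dots> u \<in> relL s t" for u
      by (rule frag_extend_in_tensor2_rel) (auto simp: distrib_left tensor2_rel_left)
    finally show "(\<lambda>(x, y). M y (g (S' x))) (x, y + y') - (\<lambda>(x, y). M y (g (S' x))) (x, y)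
        - (\<lambda>(x, y). M y (g (S' x))) (x, y') \<in> relL s t"
      by simp
  next
    fix x x' y
    show "(\<lambda>(x, y). M y (g (S' x))) (x + x', y) - (\<lambda>(x, y). M y (g (S' x))) (x, y)
        - (\<lambda>(x, y). M y (g (S' x))) (x', y) \<in> relL s t"
      using M_relL[OF coproduct_rep_add[OF g, of "S' x" "S' x'"]]
      by (simp add: S'_add M_diff)
  next
    fix l x y
    \<comment> \<open>Here balance rests on \<open>S' (t l * x) = S' x * s l\<close>.\<close>
    have "M (s l) (g (S' x)) \<in> \<gamma> (S' x * s l)"
      unfolding \<gamma>_mult_s[OF g] by (simp add: M_def mem_coset_iff)
    from M_relL[OF \<gamma>_diff_in_relL[OF g this], of y]
    have "M y (g (S' (t l * x))) - M (s l * y) (g (S' x)) \<in> relL s t"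
      by (simp add: M_diff M_mult S'_mult)
    then show "(\<lambda>(x, y). M y (g (S' x))) (t l * x, y) - (\<lambda>(x, y). M y (g (S' x))) (x, s l * y) \<in> relL s t"
      by simp
  qed
  then have "frag_extend (\<lambda>(x, y). M y (g (S' x))) (g a) - frag_extend (\<lambda>(x, y). M y (g (S' x))) (d a)
      \<in> relL s t"
    by (simp add: frag_extend_diff)
  moreover have "frag_extend (\<lambda>(x, y). M y (g (S' x))) (d a) - frag_extend h (left_cop d (d a)) \<in> relL s t"
  proof -
    have "frag_extend h (left_cop d (d a))
        = frag_extend (\<lambda>(x, y). M y (frag_extend (\<lambda>(x, y). frag_of (S y, S' x)) (d x))) (d a)"
      by (simp add: left_cop_def h_def M_def frag_extend_frag_extend case_prod_unfold)
    moreover have "M y (g (S' x)) - M y (frag_extend (\<lambda>(x, y). frag_of (S y, S' x)) (d x)) \<in> relL s t" for x y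
      using M_relL[OF \<gamma>_diff_in_relL[OF g S_S'_mem_\<gamma>[OF d]]] by (simp add: M_diff)
    ultimately show ?thesis
      by (auto intro!: frag_extend_cong_tensor2_rel)
  qed
  moreover have "frag_extend h (left_cop d (d a)) - frag_extend h (right_cop d (d a)) \<in> relL s t"
  proof -
    have "left_cop d (d a) - right_cop d (d a) \<in> tensor3_rel scaleA scaleA"
      using tensor3_rel_coset_eqD A.\<Delta>_coassoc[OF d] by metis
    then have "frag_extend h (left_cop d (d a) - right_cop d (d a)) \<in> relL s t"
      by (rule tensor3_rel_frag_extend)
        (simp_all add: h_def S_add S'_add S_scale S'_scale distrib_left distrib_right tensor2_rel_left
          tensor2_rel_right A.scale_mult_left A.scale_mult_right scale_balanced
          tensor2_rel_diff[OF tensor2_rel_zero scale_balanced, simplified])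
    then show ?thesis
      by (simp add: frag_extend_diff)
  qed
  moreover have "frag_extend h (right_cop d (d a)) - frag_extend (\<lambda>(x, y). frag_of (1, s (\<pi> (S y)) * S' x)) (d a)
      \<in> relL s t"
  proof -
    have "frag_extend (\<lambda>(p, q). frag_of (S p * q, S' x)) (d y) - frag_of (1, s (\<pi> (S y)) * S' x) \<in> relL s t"
      for x y
    proof (rule tensor2_rel_trans)
      show "frag_extend (\<lambda>(p, q). frag_of (S p * q, S' x)) (d y) - frag_of (t (\<pi> (S y)), S' x) \<in> relL s t"
        using frag_extend_frag_of_left[of "\<lambda>(p, q). S p * q" "S' x" "d y" "\<lambda>l x. s l * x" "\<lambda>l x. t l * x"]
        by (simp add: S_antipode[OF \<Delta>_subset_\<gamma>[OF d], unfolded case_prod_unfold] case_prod_unfold)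
      \<comment> \<open>The scalar now crosses from the first factor, read as
        \<open>t (\<pi> (S y)) * 1\<close>, to the second.\<close>
      show "frag_of (t (\<pi> (S y)), S' x) - frag_of (1, s (\<pi> (S y)) * S' x) \<in> relL s t"
        using relL_balanced[of "\<pi> (S y)" 1 "S' x"] by simp
    qed
    moreover have "frag_extend h (right_cop d (d a))
        = frag_extend (\<lambda>(x, y). frag_extend (\<lambda>(p, q). frag_of (S p * q, S' x)) (d y)) (d a)"
      by (simp add: right_cop_def h_def frag_extend_frag_extend case_prod_unfold)
    ultimately show ?thesis
      by (auto intro!: frag_extend_cong_tensor2_rel)
  qed
  moreover have "frag_extend (\<lambda>(x, y). frag_of (1, s (\<pi> (S y)) * S' x)) (d a) - frag_of (1, S' a) \<in> relL s t"
  proof -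
    have "lin_extend (\<lambda>(x, y). s (\<pi> (S y)) * S' x) (d a) = S' a"
      using counit_left[OF S_S'_mem_\<gamma>[OF d, of a]]
      by (simp add: lin_extend_frag_extend case_prod_unfold)
    with frag_extend_frag_of_right[of 1 "\<lambda>(x, y). s (\<pi> (S y)) * S' x" "d a" "\<lambda>l x. s l * x" "\<lambda>l x. t l * x"]
    show ?thesis
      by (simp add: case_prod_unfold)
  qed
  ultimately show ?thesis
    unfolding M_def by (blast intro: tensor2_rel_trans)
qed

end

theorem proposition4p15:
  fixes scaleA :: "'k::{comm_ring, comm_monoid_mult} \<Rightarrow> 'a::{ring, monoid_mult} \<Rightarrow> 'a"
    and scaleL :: "'k \<Rightarrow> 'l::{ring, monoid_mult} \<Rightarrow> 'l"
    and s t :: "'l \<Rightarrow> 'a"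
    and \<gamma> \<Delta> :: "'a \<Rightarrow> ('a \<times> 'a \<Rightarrow>\<^sub>0 int) set"
    and \<pi> :: "'a \<Rightarrow> 'l"
    and S S' :: "'a \<Rightarrow> 'a"
  assumes "extended_hopf_algebra scaleA scaleL s t \<gamma> \<pi> \<Delta> S S'"
  shows "hopf_algebroid s t \<gamma> \<pi> S'"
proof -
  interpret extended_hopf_algebra scaleA scaleL s t \<gamma> \<pi> \<Delta> S S'
    by (fact assms)
  show ?thesis
    \<comment> \<open>\<open>inv_S'\<close> and \<open>tensor2_rel_coset_eq_iff\<close> bring both
      coset equations into the form of the two lemmas.\<close>
    by unfold_locales
      (simp_all add: ring_anti_automorphism_S' inv_S' tensor2_rel_coset_eq_iff antipode_axiom inv_antipode_axiom)
qed

end
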